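(* Let $n$ be a positive integer and let $W\subset \mathbb{R}^{n+1}$ be a convex body containing the origin of $\mathbb{R}^{n+1}$ as an interior point. Then $W$ is strictly convex if and only if its convex integrand $\gamma_{W}: S^n\to\mathbb{R}_+$ is of class $C^1$.
   Context: $S^n$ is the unit sphere of $\mathbb{R}^{n+1}$ and $\mathbb{R}_+=\{a\in\mathbb{R} : a>0\}$. A convex body is a compact convex set with non-empty interior. A convex body $W$ is strictly convex if its boundary $\partial W$ contains no line segment joining two distinct points. For a continuous function $\gamma:S^n\to\mathbb{R}_+$, the Wulff shape associated with $\gamma$ is $$\mathcal{W}_\gamma=\bigcap_{\theta\in S^n}\{x\in\mathbb{R}^{n+1} : x\cdot\theta\le\gamma(\theta)\},$$ where $\cdot$ is the standard dot product. For a convex body $W\subset\mathbb{R}^{n+1}$ with the origin in its interior, let $C^0_W(S^n,\mathbb{R}_+)$ be the set of continuous functions $\gamma:S^n\to\mathbb{R}_+$ with $\mathcal{W}_\gamma=W$. It is known that this set is non-empty and has a smallest element $\gamma_W$, i.e. $\gamma_W\in C^0_W(S^n,\mathbb{R}_+)$ and $\gamma_W(\theta)\le\gamma(\theta)$ for all $\theta\in S^n$ and all $\gamma\in C^0_W(S^n,\mathbb{R}_+)$. The function $\gamma_W$ is called the convex integrand of $W$. *)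

theory Defs
  imports "HOL-Analysis.Analysis"
begin

definition convex_body :: "'a::euclidean_space set \<Rightarrow> bool" where
  "convex_body W \<longleftrightarrow> compact W \<and> convex W \<and> interior W \<noteq> {}"

definition strictly_convex :: "'a::euclidean_space set \<Rightarrow> bool" where
  "strictly_convex W \<longleftrightarrow>
    \<not> (\<exists>x y. x \<noteq> y \<and> closed_segment x y \<subseteq> frontier W)"

definition wulff_shape :: "('a::euclidean_space \<Rightarrow> real) \<Rightarrow> 'a set" where
  "wulff_shape \<gamma> = (\<Inter>\<theta>\<in>sphere 0 1. {x. x \<bullet> \<theta> \<le> \<gamma> \<theta>})"

(* Functions on the unit sphere are represented extensionally (a fixed dummy value off the
   sphere), so that equality of elements of this set is equality of functions on the sphere. *)
definition wulff_functions :: "'a::euclidean_space set \<Rightarrow> ('a \<Rightarrow> real) set" where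
  "wulff_functions W =
    {\<gamma> \<in> sphere 0 1 \<rightarrow>\<^sub>E {0<..}. continuous_on (sphere 0 1) \<gamma> \<and> wulff_shape \<gamma> = W}"

(* The smallest element of wulff_functions W, which exists when W is a convex body with the
   origin in its interior. *)
definition convex_integrand :: "'a::euclidean_space set \<Rightarrow> 'a \<Rightarrow> real" where
  "convex_integrand W =
    (THE \<gamma>. \<gamma> \<in> wulff_functions W \<and>
      (\<forall>\<gamma>'\<in>wulff_functions W. \<forall>\<theta>\<in>sphere 0 1. \<gamma> \<theta> \<le> \<gamma>' \<theta>))"

(* Class C^1 on a subset S of a Euclidean space, in the usual sense of differential topology:
   near each point of S the function is the restriction of a C^1 function defined on an open
   subset of the ambient space. For an embedded submanifold such as the unit sphere this is
   the same as being C^1 in charts. The values of f outside S are irrelevant. *)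
definition C1_on :: "'a::euclidean_space set \<Rightarrow> ('a \<Rightarrow> real) \<Rightarrow> bool" where
  "C1_on S f \<longleftrightarrow>
    (\<forall>p\<in>S. \<exists>U F F'. open U \<and> p \<in> U \<and>
      (\<forall>x\<in>U. (F has_derivative blinfun_apply (F' x)) (at x)) \<and>
      continuous_on U F' \<and>
      (\<forall>x\<in>S \<inter> U. F x = f x))"

end

theory Submission
  imports Defs
begin

text \<open>
  The convex integrand of \<open>W\<close> is the restriction to the unit sphere of the support function
  \<open>h\<close> of \<open>W\<close>. If \<open>W\<close> is strictly convex, the maximiser \<open>m x\<close> of \<open>w \<mapsto> w \<bullet> x\<close> on \<open>W\<close> is
  unique for \<open>x \<noteq> 0\<close>, hence continuous in \<open>x\<close> by compactness, and
  \<open>(y - x) \<bullet> m x \<le> h y - h x \<le> (y - x) \<bullet> m y\<close> shows that \<open>m\<close> is the gradient of \<open>h\<close>.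
  Conversely, if the boundary contains a segment with end points \<open>a \<noteq> b\<close>, a supporting hyperplane
  at the midpoint, with normal \<open>\<theta>\<close>, contains both of them. Along the great circle through \<open>\<theta>\<close> in
  the direction \<open>a - b\<close> the function \<open>h\<close> then has the two distinct minorants given by \<open>a\<close> and
  \<open>b\<close>, both touching at \<open>\<theta>\<close>, so it is not differentiable there.
\<close>

section \<open>Support functions of compact convex sets\<close>

definition support_function :: "'a::euclidean_space set \<Rightarrow> 'a \<Rightarrow> real" where
  "support_function S x = (SUP w\<in>S. w \<bullet> x)"

lemma support_function_attained:
  assumes "compact S" "S \<noteq> {}"
  obtains w where "w \<in> S" "support_function S x = w \<bullet> x"
proof -
  have "continuous_on S (\<lambda>w. w \<bullet> x)"
    by (intro continuous_intros)
  then obtain w where w: "w \<in> S" "\<forall>v\<in>S. v \<bullet> x \<le> w \<bullet> x"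
    using continuous_attains_sup assms by metis
  then have "support_function S x = w \<bullet> x"
    unfolding support_function_def by (intro cSup_eq_maximum) auto
  with w that show ?thesis by blast
qed

lemma inner_le_support_function:
  assumes "compact S" "w \<in> S"
  shows "w \<bullet> x \<le> support_function S x"
proof -
  have "bounded ((\<lambda>w. w \<bullet> x) ` S)"
    by (intro compact_imp_bounded compact_continuous_image assms continuous_intros)
  then show ?thesis
    unfolding support_function_def
    by (intro cSUP_upper assms bounded_imp_bdd_above)
qed

text \<open>A maximiser for \<open>y\<close> is merely a competitor for \<open>x\<close>. Used with
  the roles exchanged, this gives both the Lipschitz bound and the two-sided estimate behind
  differentiability.\<close>

lemma support_function_diff_le:
  assumes "compact S" "w \<in> S" "support_function S y = w \<bullet> y"
  shows "support_function S y - support_function S x \<le> w \<bullet> (y - x)"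
  using inner_le_support_function[OF assms(1,2), of x] assms(3) by (simp add: inner_diff_right)

lemma continuous_on_support_function:
  assumes "compact S" "S \<noteq> {}"
  shows "continuous_on X (support_function S)"
proof -
  \<comment> \<open>Any bound on the norms of the points of \<open>S\<close> serves as a Lipschitz
    constant.\<close>
  obtain R where R: "R > 0" "\<And>w. w \<in> S \<Longrightarrow> norm w \<le> R"
    using compact_imp_bounded[OF assms(1)] bounded_pos by metis
  have le: "support_function S y - support_function S x \<le> R * norm (y - x)" for x y
  proof -
    obtain w where w: "w \<in> S" "support_function S y = w \<bullet> y"
      using support_function_attained[OF assms] by metis
    have "w \<bullet> (y - x) \<le> norm w * norm (y - x)"
      by (rule norm_cauchy_schwarz)
    also have "\<dots> \<le> R * norm (y - x)"
      using R(2)[OF w(1)] by (intro mult_right_mono) auto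
    finally show ?thesis
      using support_function_diff_le[OF assms(1) w, of x] by linarith
  qed
  have "R-lipschitz_on X (support_function S)"
  proof (rule lipschitz_onI)
    show "dist (support_function S x) (support_function S y) \<le> R * dist x y" for x y
      using le[of x y] le[of y x] by (simp add: dist_norm norm_minus_commute abs_le_iff)
  qed (use R in simp)
  then show ?thesis
    by (rule lipschitz_on_continuous_on)
qed

text \<open>From an interior point one can move a little in direction \<open>x\<close> without
  leaving \<open>S\<close>, which strictly increases the product with \<open>x\<close>.\<close>

lemma interior_inner_less_support_function:
  assumes "compact S" "z \<in> interior S" "x \<noteq> 0"
  shows "z \<bullet> x < support_function S x"
proof -
  obtain e where e: "e > 0" "cball z e \<subseteq> S"
    using assms(2) mem_interior_cball by metis
  have "z + (e / norm x) *\<^sub>R x \<in> S"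
    using e assms(3) by (intro subsetD[OF e(2)]) (simp add: dist_norm)
  from inner_le_support_function[OF assms(1) this, of x]
  have "z \<bullet> x + (e / norm x) * (x \<bullet> x) \<le> support_function S x"
    by (simp add: inner_add_left)
  moreover have "(e / norm x) * (x \<bullet> x) > 0"
    using e assms(3) by simp
  ultimately show ?thesis by linarith
qed

lemma mem_if_inner_le_support_function:
  assumes "compact S" "convex S" "S \<noteq> {}"
    and le: "\<And>\<theta>. norm \<theta> = 1 \<Longrightarrow> x \<bullet> \<theta> \<le> support_function S \<theta>"
  shows "x \<in> S"
proof (rule ccontr)
  assume "x \<notin> S"
  then obtain a b where ab: "a \<bullet> x < b" "\<And>w. w \<in> S \<Longrightarrow> b < a \<bullet> w"
    using separating_hyperplane_closed_point[OF assms(2) compact_imp_closed[OF assms(1)]] by metis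
  have "a \<noteq> 0"
    using ab assms(3) by force
  \<comment> \<open>The separation puts \<open>S\<close> on the side of larger products with
    \<open>a\<close>, so the direction that \<open>x\<close> violates is the opposite one, scaled to
    unit length.\<close>
  define \<theta> where "\<theta> = - (a /\<^sub>R norm a)"
  obtain w where w: "w \<in> S" "support_function S \<theta> = w \<bullet> \<theta>"
    using support_function_attained[OF assms(1,3)] by metis
  have "norm \<theta> = 1"
    using \<open>a \<noteq> 0\<close> by (simp add: \<theta>_def)
  from le[OF this] w(2) have "(a \<bullet> w) / norm a \<le> (a \<bullet> x) / norm a"
    by (simp add: \<theta>_def inner_commute divide_inverse mult.commute)
  then have "a \<bullet> w \<le> a \<bullet> x"
    using \<open>a \<noteq> 0\<close> by (simp add: divide_le_cancel)
  with ab(1) ab(2)[OF w(1)] show False by linarith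
qed

section \<open>Wulff shapes and the convex integrand\<close>

lemma wulff_shape_cong:
  assumes "\<And>\<theta>. norm \<theta> = 1 \<Longrightarrow> f \<theta> = g \<theta>"
  shows "wulff_shape f = wulff_shape g"
  using assms by (auto simp: wulff_shape_def)

lemma wulff_shape_support_function:
  assumes "compact S" "convex S" "S \<noteq> {}"
  shows "wulff_shape (support_function S) = S"
proof
  show "wulff_shape (support_function S) \<subseteq> S"
    using mem_if_inner_le_support_function[OF assms] by (auto simp: wulff_shape_def)
  show "S \<subseteq> wulff_shape (support_function S)"
    using inner_le_support_function[OF assms(1)] by (auto simp: wulff_shape_def)
qed

text \<open>The support function has Wulff shape \<open>W\<close>. It is least because a maximiser
  for \<open>\<theta>\<close> lies in \<open>W = wulff_shape \<gamma>\<close>, and the constraint it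
  satisfies at \<open>\<theta>\<close> is the desired inequality.\<close>

lemma convex_integrand_eq_support_function:
  assumes "compact W" "convex W" "0 \<in> interior W"
  shows "convex_integrand W = restrict (support_function W) (sphere 0 1)"
  unfolding convex_integrand_def
proof (rule the_equality)
  let ?h = "restrict (support_function W) (sphere 0 1)"
  have ne: "W \<noteq> {}"
    using assms(3) interior_subset by blast
  have "continuous_on (sphere 0 1) ?h"
    using continuous_on_support_function[OF assms(1) ne] by (rule continuous_on_eq) simp
  moreover have "wulff_shape ?h = W"
    using wulff_shape_support_function[OF assms(1,2) ne] wulff_shape_cong[of ?h "support_function W"]
    by simp
  moreover have "support_function W \<theta> > 0" if "norm \<theta> = 1" for \<theta>
    using interior_inner_less_support_function[OF assms(1,3), of \<theta>] that by force
  ultimately have mem: "?h \<in> wulff_functions W"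
    by (auto simp: wulff_functions_def)
  have least: "?h \<theta> \<le> \<gamma> \<theta>" if \<gamma>: "\<gamma> \<in> wulff_functions W" and \<theta>: "\<theta> \<in> sphere 0 1" for \<gamma> \<theta>
  proof -
    obtain w where w: "w \<in> W" "support_function W \<theta> = w \<bullet> \<theta>"
      using support_function_attained[OF assms(1) ne] by metis
    have "w \<in> wulff_shape \<gamma>"
      using w(1) \<gamma> by (simp add: wulff_functions_def)
    with \<theta> w(2) show ?thesis
      by (auto simp: wulff_shape_def)
  qed
  show "?h \<in> wulff_functions W \<and> (\<forall>\<gamma>\<in>wulff_functions W. \<forall>\<theta>\<in>sphere 0 1. ?h \<theta> \<le> \<gamma> \<theta>)"
    using mem least by blast
  fix \<gamma>
  assume \<gamma>: "\<gamma> \<in> wulff_functions W \<and>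
    (\<forall>\<gamma>'\<in>wulff_functions W. \<forall>\<theta>\<in>sphere 0 1. \<gamma> \<theta> \<le> \<gamma>' \<theta>)"
  show "\<gamma> = ?h"
  \<comment> \<open>On the sphere two least elements bound each other; off it both take the same
    default value.\<close>
  proof (rule PiE_ext)
    show "\<gamma> \<in> sphere 0 1 \<rightarrow>\<^sub>E {0<..}" "?h \<in> sphere 0 1 \<rightarrow>\<^sub>E {0<..}"
      using \<gamma> mem unfolding wulff_functions_def by blast+
    show "\<gamma> \<theta> = ?h \<theta>" if "\<theta> \<in> sphere 0 1" for \<theta>
      using \<gamma> mem least that by (meson order_antisym)
  qed
qed

section \<open>From strict convexity to class C^1\<close>

lemma support_point_unique:
  assumes "compact W" "convex W" "strictly_convex W" "x \<noteq> 0"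
    and a: "a \<in> W" "support_function W x = a \<bullet> x"
    and b: "b \<in> W" "support_function W x = b \<bullet> x"
  shows "a = b"
proof (rule ccontr)
  assume "a \<noteq> b"
  \<comment> \<open>The maximisers of a linear functional form a face: it contains the segment
    between two of its points, and none of its points is interior.\<close>
  have "z \<in> frontier W" if z: "z \<in> closed_segment a b" for z
  proof -
    have "z \<in> W"
      using z a(1) b(1) assms(2) closed_segment_subset by blast
    obtain u where "z = (1 - u) *\<^sub>R a + u *\<^sub>R b"
      using z in_segment(1) by metis
    then have "z \<bullet> x = (1 - u) * (a \<bullet> x) + u * (b \<bullet> x)"
      by (simp add: inner_add_left)
    also have "\<dots> = support_function W x"
      using a(2) b(2) by (simp add: algebra_simps)
    finally have "z \<notin> interior W"
      using interior_inner_less_support_function[OF assms(1) _ assms(4)] by force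
    with \<open>z \<in> W\<close> show ?thesis
      using closure_subset by (auto simp: frontier_def)
  qed
  with \<open>a \<noteq> b\<close> assms(3) show False
    unfolding strictly_convex_def by blast
qed

lemma strictly_convex_imp_C1_on:
  assumes "compact W" "convex W" "W \<noteq> {}" "strictly_convex W" "0 \<notin> X"
  shows "C1_on X (support_function W)"
proof -
  let ?h = "support_function W"
  have "\<forall>x. \<exists>w. w \<in> W \<and> ?h x = w \<bullet> x"
    using support_function_attained[OF assms(1,3)] by metis
  then obtain m where m: "\<And>x. m x \<in> W" "\<And>x. ?h x = m x \<bullet> x"
    by metis
  \<comment> \<open>By uniqueness the graph of \<open>m\<close> is cut out by a closed condition;
    since the target \<open>W\<close> is compact, a closed graph makes \<open>m\<close>
    continuous.\<close>
  have "(\<lambda>x. (x, m x)) ` (- {0}) = ((- {0}) \<times> W) \<inter> {p. ?h (fst p) = snd p \<bullet> fst p}"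
    using m support_point_unique[OF assms(1,2,4)] by (auto simp: image_iff)
  moreover have "closed {p. ?h (fst p) = snd p \<bullet> fst p}"
    by (intro closed_Collect_eq continuous_intros
        continuous_on_compose2[OF continuous_on_support_function[OF assms(1,3), of UNIV]]) auto
  ultimately have "closedin (top_of_set ((- {0}) \<times> W)) ((\<lambda>x. (x, m x)) ` (- {0}))"
    by (simp add: closedin_closed_Int)
  then have cont: "continuous_on (- {0}) m"
    using continuous_closed_graph_eq[OF assms(1), of m "- {0}"] m(1) by blast
  have deriv: "(?h has_derivative blinfun_inner_right (m x)) (at x)" if "x \<noteq> 0" for x
  proof -
    have "m \<midarrow>x\<rightarrow> m x"
      using cont that continuous_on_eq_continuous_at[of "- {0}" m]
      by (auto simp: isCont_def open_Compl)
    then have lim: "((\<lambda>y. norm (m y - m x)) \<longlongrightarrow> 0) (at x)"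
      using LIM_zero tendsto_norm_zero by blast
    \<comment> \<open>The error of the linear approximation lies between \<open>0\<close> and
      \<open>(m y - m x) \<bullet> (y - x)\<close>, so continuity of \<open>m\<close> alone makes it
      \<open>o(norm (y - x))\<close>.\<close>
    have bound: "norm ((?h y - ?h x - m x \<bullet> (y - x)) /\<^sub>R norm (y - x)) \<le> norm (m y - m x)" for y
    proof -
      have "m x \<bullet> (y - x) \<le> ?h y - ?h x" "?h y - ?h x \<le> m y \<bullet> (y - x)"
        using support_function_diff_le[OF assms(1) m, of y x]
          support_function_diff_le[OF assms(1) m, of x y]
        by (auto simp: inner_diff_right)
      then have "norm (?h y - ?h x - m x \<bullet> (y - x)) \<le> (m y - m x) \<bullet> (y - x)"
        by (simp add: inner_diff_left)
      also have "\<dots> \<le> norm (m y - m x) * norm (y - x)"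
        by (rule norm_cauchy_schwarz)
      finally show ?thesis
        by (cases "y = x") (auto simp: field_simps)
    qed
    show ?thesis
      unfolding has_derivative_at2
    proof
      show "bounded_linear (blinfun_inner_right (m x))"
        by (rule blinfun.bounded_linear_right)
      show "(\<lambda>y. (1 / norm (y - x)) *\<^sub>R (?h y - (?h x + blinfun_inner_right (m x) (y - x))))
        \<midarrow>x\<rightarrow> 0"
        using bound
        by (intro Lim_null_comparison[OF always_eventually lim])
          (auto simp: diff_diff_eq divide_inverse)
    qed
  qed
  have "continuous_on (- {0}) (\<lambda>x. blinfun_inner_right (m x))"
    by (intro bounded_linear.continuous_on[OF bounded_linear_blinfun_inner_right] cont)
  then show ?thesis
    unfolding C1_on_def using deriv assms(5)
    by (intro ballI exI[of _ "- {0}"] exI[of _ ?h] exI[of _ "\<lambda>x. blinfun_inner_right (m x)"])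
      (auto simp: open_Compl)
qed

section \<open>From class C^1 to strict convexity\<close>

lemma C1_on_sphere_imp_strictly_convex:
  assumes "compact W" "convex W" "interior W \<noteq> {}"
    and C1: "C1_on (sphere 0 1) (support_function W)"
  shows "strictly_convex W"
  unfolding strictly_convex_def
proof (intro notI, elim exE conjE)
  let ?h = "support_function W"
  fix a b :: 'a
  assume "a \<noteq> b" and seg: "closed_segment a b \<subseteq> frontier W"
  then have "a \<in> frontier W" "b \<in> frontier W" "midpoint a b \<in> frontier W"
    using ends_in_segment midpoint_in_closed_segment by blast+
  then have ab: "a \<in> W" "b \<in> W" "midpoint a b \<in> W" "midpoint a b \<notin> interior W"
    using frontier_subset_closed[OF compact_imp_closed[OF assms(1)]] by (auto simp: frontier_def)
  have "midpoint a b \<notin> rel_interior W"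
    using ab(4) rel_interior_nonempty_interior[OF assms(3)] by simp
  with supporting_hyperplane_rel_boundary[OF assms(2) ab(3)]
  obtain c where c: "c \<noteq> 0" "\<And>y. y \<in> W \<Longrightarrow> c \<bullet> midpoint a b \<le> c \<bullet> y"
    by metis
  \<comment> \<open>\<open>c\<close> is minimised over \<open>W\<close> at the midpoint; reversing
    and normalising it gives the outer unit normal.\<close>
  define \<theta> where "\<theta> = - (c /\<^sub>R norm c)"
  have \<theta>: "norm \<theta> = 1"
    using c(1) by (simp add: \<theta>_def)
  have max: "y \<bullet> \<theta> \<le> midpoint a b \<bullet> \<theta>" if "y \<in> W" for y
    using c(2)[OF that] by (simp add: \<theta>_def inner_commute mult_left_mono)
  have mid: "midpoint a b \<bullet> \<theta> = (a \<bullet> \<theta> + b \<bullet> \<theta>) / 2"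
    by (simp add: midpoint_def inner_add_left)
  have "?h \<theta> = midpoint a b \<bullet> \<theta>"
    using support_function_attained[OF assms(1), of \<theta>] max
      inner_le_support_function[OF assms(1) ab(3), of \<theta>] ab(1)
    by (metis empty_iff order_antisym)
  \<comment> \<open>The maximum is the average of the values at \<open>a\<close> and
    \<open>b\<close>, neither of which exceeds it, so both attain it.\<close>
  with mid max[OF ab(1)] max[OF ab(2)] have eq: "?h \<theta> = a \<bullet> \<theta>" "?h \<theta> = b \<bullet> \<theta>"
    by (simp_all add: field_simps)
  define v where "v = (a - b) /\<^sub>R norm (a - b)"
  have v: "norm v = 1" "\<theta> \<bullet> v = 0"
    using \<open>a \<noteq> b\<close> eq by (auto simp: v_def inner_diff_right inner_commute)
  \<comment> \<open>The local extension \<open>F\<close> agrees with \<open>?h\<close> only on the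
    sphere, so it is compared along a curve there: the great circle leaving \<open>\<theta>\<close>
    with velocity \<open>v\<close>.\<close>
  define k where "k t = cos t *\<^sub>R \<theta> + sin t *\<^sub>R v" for t :: real
  have k0: "k 0 = \<theta>"
    by (simp add: k_def)
  have k_norm: "norm (k t) = 1" for t
  proof -
    have "\<theta> \<bullet> \<theta> = 1" "v \<bullet> v = 1" "v \<bullet> \<theta> = 0"
      using \<theta> v by (auto simp: dot_square_norm inner_commute)
    then have "k t \<bullet> k t = (cos t)\<^sup>2 + (sin t)\<^sup>2"
      using v(2) by (simp add: k_def inner_add_left inner_add_right power2_eq_square)
    then show ?thesis
      by (simp add: norm_eq_sqrt_inner)
  qed
  have k_deriv: "(k has_derivative (\<lambda>t. t *\<^sub>R v)) (at 0)"
    unfolding k_def by (auto intro!: derivative_eq_intros)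
  obtain U F F' where U: "open U" "\<theta> \<in> U"
    and F: "(F has_derivative blinfun_apply (F' \<theta>)) (at \<theta>)"
    and Fh: "\<And>x. x \<in> sphere 0 1 \<inter> U \<Longrightarrow> F x = ?h x"
    using C1 \<theta> unfolding C1_on_def by (metis mem_sphere_0)
  have "(k \<longlongrightarrow> \<theta>) (at 0)"
    using has_derivative_continuous[OF k_deriv] k0 by (simp add: isCont_def)
  then have ev: "\<forall>\<^sub>F t in at 0. k t \<in> U"
    using U topological_tendstoD by blast
  \<comment> \<open>Along \<open>k\<close> the function \<open>F\<close> lies above the minorant
    given by \<open>w\<close> and touches it at time \<open>0\<close>, so the derivative of the
    difference vanishes there.\<close>
  have deriv_eq: "F' \<theta> v = w \<bullet> v" if w: "w \<in> W" "?h \<theta> = w \<bullet> \<theta>" for w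
  proof -
    have "(F \<circ> k has_derivative (blinfun_apply (F' \<theta>) \<circ> (\<lambda>t. t *\<^sub>R v))) (at 0)"
      using k_deriv F k0 by (intro diff_chain_at) auto
    moreover have "((\<lambda>t. w \<bullet> k t) has_derivative (\<lambda>t. w \<bullet> (t *\<^sub>R v))) (at 0)"
      by (rule has_derivative_inner_right[OF k_deriv])
    ultimately have "((\<lambda>t. (F \<circ> k) t - w \<bullet> k t) has_derivative
        (\<lambda>t. (blinfun_apply (F' \<theta>) \<circ> (\<lambda>t. t *\<^sub>R v)) t - w \<bullet> (t *\<^sub>R v))) (at 0)"
      by (rule has_derivative_diff)
    moreover have "\<forall>\<^sub>F t in at 0. (F \<circ> k) 0 - w \<bullet> k 0 \<le> (F \<circ> k) t - w \<bullet> k t"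
      using ev
    proof eventually_elim
      case (elim t)
      then have "F (k t) = ?h (k t)" "F \<theta> = ?h \<theta>"
        using Fh k_norm \<theta> U by auto
      with inner_le_support_function[OF assms(1) w(1), of "k t"] w(2) show ?case
        by (simp add: k0)
    qed
    ultimately have "(\<lambda>t. (blinfun_apply (F' \<theta>) \<circ> (\<lambda>t. t *\<^sub>R v)) t - w \<bullet> (t *\<^sub>R v)) = (\<lambda>t. 0)"
      by (rule has_derivative_local_min)
    from fun_cong[OF this, of 1] show ?thesis by simp
  qed
  \<comment> \<open>Both minorants prescribe the same derivative of \<open>F\<close>, yet this
    product equals \<open>norm (a - b)\<close>.\<close>
  have "(a - b) \<bullet> v = 0"
    using deriv_eq[OF ab(1) eq(1)] deriv_eq[OF ab(2) eq(2)] by (simp add: inner_diff_left)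
  with \<open>a \<noteq> b\<close> show False
    by (simp add: v_def)
qed

lemma C1_on_restrict: "C1_on S (restrict f S) \<longleftrightarrow> C1_on S f"
  by (simp add: C1_on_def)

theorem theorem1:
  fixes n :: nat and W :: "(real ^ 'd) set"
  assumes "n \<ge> 1" and "CARD('d) = n + 1"
    and "convex_body W" and "0 \<in> interior W"
  shows "strictly_convex W \<longleftrightarrow> C1_on (sphere 0 1) (convex_integrand W)"
proof -
  have W: "compact W" "convex W" "interior W \<noteq> {}" "W \<noteq> {}"
    using assms(3) interior_subset by (auto simp: convex_body_def)
  have "strictly_convex W \<longleftrightarrow> C1_on (sphere 0 1) (support_function W)"
    using strictly_convex_imp_C1_on[OF W(1,2,4), of "sphere 0 1"]
      C1_on_sphere_imp_strictly_convex[OF W(1-3)] by auto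
  then show ?thesis
    by (simp add: convex_integrand_eq_support_function[OF W(1,2) assms(4)] C1_on_restrict)
qed

end
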